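(* Let $m=pq$ where $p$ and $q$ are different odd primes, and let $n$ be a positive integer. Then the graph $G=C_m\odot\overline{K}_n$ is perfect super edge-magic.
   Context: For graphs $G,H$, the corona product $G\odot H$ is obtained from one copy of $G$ and $|V(G)|$ copies of $H$ by joining each vertex of $G$ to all vertices of one copy of $H$, in such a way that all vertices in the same copy of $H$ are joined to exactly one vertex of $G$. $C_m$ is the cycle of order $m$ and $\overline{K}_n$ is the graph with $n$ vertices and no edges; so $C_m\odot\overline{K}_n$ is the cycle $C_m$ with $n$ pendant vertices attached to each cycle vertex. Let $G=(V,E)$ be a graph with $P=|V|$ vertices and $Q=|E|$ edges. An edge-magic labeling of $G$ is a bijection $f:V\cup E\to\{1,\dots,P+Q\}$ such that $f(x)+f(xy)+f(y)=k$ for every edge $xy\in E$, where $k$ is a constant called the valence of $f$. It is a super edge-magic labeling if moreover $f(V)=\{1,\dots,P\}$. Let $S_G$ be the set of all numbers $\frac1Q\left(\sum_{u\in V}\deg(u)g(u)+\sum_{i=P+1}^{P+Q}i\right)$, where $g$ ranges over all bijections $V\to\{1,\dots,P\}$. If $\lceil\min S_G\rceil\le\lfloor\max S_G\rfloor$, the super edge-magic interval of $G$ is $I_G=[\lceil\min S_G\rceil,\lfloor\max S_G\rfloor]\cap\mathbb{Z}$, and the super edge-magic set $\sigma_G$ is the set of all $k\in I_G$ such that $k$ is the valence of some super edge-magic labeling of $G$. $G$ is called perfect super edge-magic if $\sigma_G=I_G$. *)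

theory Defs
  imports Complex_Main "HOL-Computational_Algebra.Primes"
begin

record 'a ugraph =
  verts :: "'a set"
  edges :: "'a set set"

definition simple_graph :: "'a ugraph \<Rightarrow> bool" where
  "simple_graph G \<longleftrightarrow> finite (verts G) \<and> (\<forall>e\<in>edges G. e \<subseteq> verts G \<and> card e = 2)"

definition degree :: "'a ugraph \<Rightarrow> 'a \<Rightarrow> nat" where
  "degree G u = card {e \<in> edges G. u \<in> e}"

text \<open>This is the cycle of order \<open>m\<close> for \<open>m \<ge> 3\<close>; smaller \<open>m\<close> are degenerate.\<close>

definition cycle_graph :: "nat \<Rightarrow> nat ugraph" where
  "cycle_graph m = \<lparr>verts = {..<m}, edges = {{i, Suc i mod m} | i. i < m}\<rparr>"

definition edgeless_graph :: "nat \<Rightarrow> nat ugraph" where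
  "edgeless_graph n = \<lparr>verts = {..<n}, edges = {}\<rparr>"

text \<open>\<open>Inl v\<close> is the vertex \<open>v\<close> of \<open>G\<close>, and \<open>Inr (v, w)\<close> is the vertex \<open>w\<close> in the copy
  of \<open>H\<close> whose vertices are all joined to \<open>v\<close>.\<close>

definition corona :: "'a ugraph \<Rightarrow> 'b ugraph \<Rightarrow> ('a + 'a \<times> 'b) ugraph" where
  "corona G H =
     \<lparr>verts = verts G <+> verts G \<times> verts H,
      edges = {Inl ` e | e. e \<in> edges G}
            \<union> {(\<lambda>w. Inr (v, w)) ` e | v e. v \<in> verts G \<and> e \<in> edges H}
            \<union> {{Inl v, Inr (v, w)} | v w. v \<in> verts G \<and> w \<in> verts H}\<rparr>"

text \<open>The domain \<open>V \<union> E\<close> of a labeling is rendered as the disjoint sum \<open>V <+> E\<close>: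
  \<open>Inl\<close> marks vertices and \<open>Inr\<close> marks edges.\<close>

definition has_valence :: "'a ugraph \<Rightarrow> ('a + 'a set \<Rightarrow> nat) \<Rightarrow> nat \<Rightarrow> bool" where
  "has_valence G f k \<longleftrightarrow>
     (\<forall>x y. {x, y} \<in> edges G \<longrightarrow> f (Inl x) + f (Inr {x, y}) + f (Inl y) = k)"

definition edge_magic_labeling :: "'a ugraph \<Rightarrow> ('a + 'a set \<Rightarrow> nat) \<Rightarrow> bool" where
  "edge_magic_labeling G f \<longleftrightarrow>
     bij_betw f (verts G <+> edges G) {1..card (verts G) + card (edges G)} \<and>
     (\<exists>k. has_valence G f k)"

definition super_edge_magic_labeling :: "'a ugraph \<Rightarrow> ('a + 'a set \<Rightarrow> nat) \<Rightarrow> bool" where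
  "super_edge_magic_labeling G f \<longleftrightarrow>
     edge_magic_labeling G f \<and> f ` Inl ` verts G = {1..card (verts G)}"

definition sem_sums :: "'a ugraph \<Rightarrow> real set" where
  "sem_sums G =
     {1 / real (card (edges G)) *
        ((\<Sum>u\<in>verts G. real (degree G u) * real (g u)) +
         (\<Sum>i = card (verts G) + 1..card (verts G) + card (edges G). real i)) | g.
      bij_betw g (verts G) {1..card (verts G)}}"

definition sem_interval_defined :: "'a ugraph \<Rightarrow> bool" where
  "sem_interval_defined G \<longleftrightarrow> \<lceil>Min (sem_sums G)\<rceil> \<le> \<lfloor>Max (sem_sums G)\<rfloor>"

definition sem_interval :: "'a ugraph \<Rightarrow> int set" where
  "sem_interval G = {\<lceil>Min (sem_sums G)\<rceil>..\<lfloor>Max (sem_sums G)\<rfloor>}"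

definition sem_set :: "'a ugraph \<Rightarrow> int set" where
  "sem_set G =
     {k \<in> sem_interval G. \<exists>f j. super_edge_magic_labeling G f \<and> has_valence G f j \<and> k = int j}"

text \<open>The interval only exists when its lower bound does not exceed its upper bound, so a
  perfect super edge-magic graph is required to satisfy this; the equation is not allowed to hold
  vacuously between empty sets.\<close>

definition perfect_super_edge_magic :: "'a ugraph \<Rightarrow> bool" where
  "perfect_super_edge_magic G \<longleftrightarrow> sem_interval_defined G \<and> sem_set G = sem_interval G"

text \<open>\<open>Min\<close> and \<open>Max\<close> above are applied to a finite nonempty set.\<close>

lemma finite_sem_sums:
  assumes "finite (verts G)"
  shows "finite (sem_sums G)"
proof -
  define F where "F g = 1 / real (card (edges G)) *
        ((\<Sum>u\<in>verts G. real (degree G u) * real (g u)) +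
         (\<Sum>i = card (verts G) + 1..card (verts G) + card (edges G). real i))" for g
  let ?T = "{g. \<forall>u. (u \<in> verts G \<longrightarrow> g u \<in> {1..card (verts G)}) \<and> (u \<notin> verts G \<longrightarrow> g u = 0)}"
  have "finite ?T"
    using assms by (intro finite_set_of_finite_funs) auto
  moreover have "sem_sums G \<subseteq> F ` ?T"
  proof
    fix s assume "s \<in> sem_sums G"
    then obtain g where g: "bij_betw g (verts G) {1..card (verts G)}" and s: "s = F g"
      by (auto simp: sem_sums_def F_def)
    let ?g = "\<lambda>u. if u \<in> verts G then g u else 0"
    have "F ?g = F g"
      by (simp add: F_def)
    moreover have "?g \<in> ?T"
      using bij_betwE[OF g] by simp
    ultimately show "s \<in> F ` ?T"
      using s imageI[of ?g ?T F] by simp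
  qed
  ultimately show ?thesis
    by (rule finite_surj)
qed

lemma sem_sums_nonempty:
  assumes "finite (verts G)"
  shows "sem_sums G \<noteq> {}"
proof -
  obtain g where "bij_betw g (verts G) {1..card (verts G)}"
    using assms finite_same_card_bij[of "verts G" "{1..card (verts G)}"] by auto
  then show ?thesis
    by (auto simp: sem_sums_def)
qed

lemma simple_graph_cycle:
  assumes "m \<ge> 3"
  shows "simple_graph (cycle_graph m)"
proof -
  have "e \<subseteq> {..<m} \<and> card e = 2" if e: "e \<in> edges (cycle_graph m)" for e
  proof -
    obtain i where i: "i < m" "e = {i, Suc i mod m}"
      using e unfolding cycle_graph_def by auto
    have "i \<noteq> Suc i mod m"
      using i(1) assms by (cases "Suc i = m") auto
    moreover have "Suc i mod m < m"
      using assms by simp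
    ultimately show ?thesis
      using i by simp
  qed
  then show ?thesis
    by (simp add: simple_graph_def cycle_graph_def)
qed

lemma simple_graph_edgeless: "simple_graph (edgeless_graph n)"
  by (simp add: simple_graph_def edgeless_graph_def)

lemma simple_graph_corona:
  assumes "simple_graph G" "simple_graph H"
  shows "simple_graph (corona G H)"
proof -
  have "e \<subseteq> verts (corona G H) \<and> card e = 2" if e: "e \<in> edges (corona G H)" for e
  proof -
    consider (G) d where "d \<in> edges G" "e = Inl ` d"
      | (H) v d where "v \<in> verts G" "d \<in> edges H" "e = (\<lambda>w. Inr (v, w)) ` d"
      | (join) v w where "v \<in> verts G" "w \<in> verts H" "e = {Inl v, Inr (v, w)}"
      using e unfolding corona_def by auto
    then show ?thesis
    proof cases
      case G
      then have "d \<subseteq> verts G" "card d = 2"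
        using assms(1) by (auto simp: simple_graph_def)
      then show ?thesis
        unfolding G(2) by (auto simp: corona_def card_image)
    next
      case H
      then have "d \<subseteq> verts H" "card d = 2"
        using assms(2) by (auto simp: simple_graph_def)
      then show ?thesis
        unfolding H(3) using H(1) by (auto simp: corona_def card_image inj_on_def)
    next
      case join
      then show ?thesis
        by (auto simp: corona_def)
    qed
  qed
  moreover have "finite (verts (corona G H))"
    using assms by (simp add: corona_def simple_graph_def)
  ultimately show ?thesis
    by (simp add: simple_graph_def)
qed

end

theory Submission
  imports Defs
begin

text \<open>
  The crown \<open>C\<^sub>m \<odot> K\<^sub>n\<close> (with \<open>K\<^sub>n\<close> edgeless) is perfect super edge-magic for every odd \<open>m \<ge> 3\<close>;
  a product of two odd primes is such an \<open>m\<close>.  Put \<open>m = 2 h + 1\<close> and \<open>N = m (n + 1)\<close>, which is the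
  number of vertices and also the number of edges.

  The interval.  In \<open>\<Sum> deg u * g u\<close> every label is counted once and the label of every cycle vertex
  \<open>n + 1\<close> further times, so a member of \<open>S\<^sub>G\<close> is \<open>2 N + 1\<close> plus the average label of a cycle vertex.
  That average is least for the labels \<open>1..m\<close> and greatest for \<open>N - m + 1..N\<close>, whence \<open>I\<^sub>G\<close> lies
  between \<open>2 N + h + 2\<close> and \<open>2 N + h + 2 + m n\<close> (\<open>sem_sums_crown_bounds\<close>).

  The labelings.  Give every vertex an edge to a cycle vertex, its hub: a leaf is sent to its only
  neighbour, a cycle vertex to its successor.  This is a bijection from vertices to edges, and every
  cycle vertex is the hub of \<open>n + 1\<close> vertices: \<open>n\<close> leaves and its predecessor.  The cycle has
  the standard labeling \<open>b\<close> by \<open>0..<m\<close> (\<open>hub_pos\<close>) in which the edge that ends in the \<open>u\<close>-th vertex has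
  sum \<open>h + u\<close>.  Write labels as \<open>m i + j + 1\<close> with \<open>i \<le> n\<close> and \<open>j < m\<close>.  The \<open>n + 1\<close> vertices with hub
  \<open>u\<close> all get as \<open>j\<close> the value of \<open>b\<close> at the predecessor of \<open>u\<close>, and the levels \<open>i = 0, \<dots>, n\<close>
  in an order that is constrained only by the level \<open>r u\<close> chosen for each cycle vertex \<open>u\<close>.  The edges
  that end in \<open>u\<close> then have the sums \<open>m (i + r u) + u + h + 2\<close> for \<open>i = 0, \<dots>, n\<close>.

  Given \<open>T \<le> m n\<close>, let \<open>r u\<close> be the number for which \<open>m r u + u\<close> is the member of the residue
  class of \<open>u\<close> in \<open>{T..<T + m}\<close>.  The edge sums are then exactly \<open>T + h + 2, \<dots>, T + h + 1 + N\<close>, and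
  consecutive edge sums extend to a super edge-magic labeling
  (\<open>super_edge_magic_labeling_if_consecutive_sums\<close>), here with valence \<open>2 N + h + 2 + T\<close>
  (\<open>crown_has_valence\<close>).  As \<open>T\<close> runs through \<open>0..m n\<close>, these fill the whole range above.  The valence of
  a super edge-magic labeling always belongs to \<open>S\<^sub>G\<close> (\<open>valence_in_sem_sums\<close>), so \<open>T = 0\<close> and
  \<open>T = m n\<close> show that the two bounds are the minimum and the maximum of \<open>S\<^sub>G\<close>.
\<close>

section \<open>Super edge-magic labelings and their valences\<close>

lemma finite_edges: "simple_graph G \<Longrightarrow> finite (edges G)"
  by (rule finite_subset[of _ "Pow (verts G)"]) (auto simp: simple_graph_def)

text \<open>Double counting: a vertex contributes its weight once for each edge through it.\<close>

lemma sum_degrees_eq_sum_edges: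
  fixes g :: "'a \<Rightarrow> nat"
  assumes "simple_graph G"
  shows "(\<Sum>u\<in>verts G. degree G u * g u) = (\<Sum>e\<in>edges G. sum g e)"
proof -
  have fin: "finite (verts G)" "finite (edges G)"
    using assms finite_edges by (auto simp: simple_graph_def)
  have "(\<Sum>e\<in>edges G. sum g e) = (\<Sum>e\<in>edges G. \<Sum>u | u \<in> verts G \<and> u \<in> e. g u)"
    using assms by (intro sum.cong arg_cong2[of _ _ _ _ sum]) (auto simp: simple_graph_def)
  also have "\<dots> = (\<Sum>u\<in>verts G. \<Sum>e | e \<in> edges G \<and> u \<in> e. g u)"
    using fin by (intro sum.swap_restrict) auto
  also have "\<dots> = (\<Sum>u\<in>verts G. degree G u * g u)"
    by (simp add: degree_def)
  finally show ?thesis ..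
qed

text \<open>Adding up the defining equation of the valence over all edges counts each vertex label once per
  incident edge and each of the labels \<open>P + 1..P + Q\<close> once.\<close>

lemma valence_in_sem_sums:
  assumes G: "simple_graph G" "edges G \<noteq> {}"
    and f: "super_edge_magic_labeling G f" and k: "has_valence G f k"
  shows "real k \<in> sem_sums G"
proof -
  let ?P = "card (verts G)" and ?Q = "card (edges G)"
  define g where "g = f \<circ> Inl"
  have fin: "finite (edges G)" and Q: "?Q > 0"
    using G finite_edges by (auto simp: card_gt_0_iff)
  have bij: "bij_betw f (verts G <+> edges G) {1..?P + ?Q}"
    and V: "f ` Inl ` verts G = {1..?P}"
    using f by (auto simp: super_edge_magic_labeling_def edge_magic_labeling_def)
  have inj: "inj_on f (verts G <+> edges G)"
    using bij by (simp add: bij_betw_def)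
  have g: "bij_betw g (verts G) {1..?P}"
    using V inj by (auto simp: bij_betw_def g_def inj_on_def image_image)
  have "f ` Inr ` edges G = f ` (verts G <+> edges G) - f ` Inl ` verts G"
    using inj by (auto simp: inj_on_def)
  also have "\<dots> = {?P + 1..?P + ?Q}"
    using bij V by (auto simp: bij_betw_def)
  finally have E: "bij_betw (f \<circ> Inr) (edges G) {?P + 1..?P + ?Q}"
    using inj by (auto simp: bij_betw_def inj_on_def image_image)
  have edge: "sum g e + f (Inr e) = k" if e: "e \<in> edges G" for e
  proof -
    obtain x y where xy: "e = {x, y}" "x \<noteq> y"
      using G(1) e by (auto simp: simple_graph_def card_2_iff)
    have "f (Inl x) + f (Inr {x, y}) + f (Inl y) = k"
      using k e unfolding xy has_valence_def by blast
    then show ?thesis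
      using xy by (simp add: g_def)
  qed
  have "?Q * k = (\<Sum>e\<in>edges G. sum g e + f (Inr e))"
    using edge by simp
  also have "\<dots> = (\<Sum>u\<in>verts G. degree G u * g u) + (\<Sum>i = ?P + 1..?P + ?Q. i)"
    using sum.reindex_bij_betw[OF E, of "\<lambda>i. i"]
    by (simp add: sum.distrib sum_degrees_eq_sum_edges[OF G(1)])
  finally have "real (?Q * k) = (\<Sum>u\<in>verts G. real (degree G u) * real (g u))
      + (\<Sum>i = ?P + 1..?P + ?Q. real i)"
    by simp
  then have "real k = 1 / real ?Q * ((\<Sum>u\<in>verts G. real (degree G u) * real (g u))
      + (\<Sum>i = ?P + 1..?P + ?Q. real i))"
    using Q by (simp add: field_simps)
  then show ?thesis
    unfolding sem_sums_def using g by blast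
qed

text \<open>The edge labels are forced to be the valence minus the edge sum; subtraction reverses the interval
  of edge sums onto the labels that the vertices leave free.\<close>

lemma super_edge_magic_labeling_if_consecutive_sums:
  assumes G: "simple_graph G"
    and g: "bij_betw g (verts G) {1..card (verts G)}"
    and s: "bij_betw (sum g) (edges G) {c..<c + card (edges G)}"
  shows "\<exists>f. super_edge_magic_labeling G f \<and>
             has_valence G f (c + card (verts G) + card (edges G))"
proof -
  let ?P = "card (verts G)" and ?Q = "card (edges G)"
  define k where "k = c + ?P + ?Q"
  define f where "f = case_sum g (\<lambda>e. k - sum g e)"
  have V: "bij_betw f (Inl ` verts G) {1..?P}"
    using g by (auto simp: f_def bij_betw_def inj_on_def image_image)
  have refl: "bij_betw (\<lambda>i. k - i) {c..<c + ?Q} {?P + 1..?P + ?Q}"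
    by (rule bij_betw_byWitness[of _ "\<lambda>i. k - i"]) (auto simp: k_def)
  have "bij_betw ((\<lambda>i. k - i) \<circ> sum g) (edges G) {?P + 1..?P + ?Q}"
    using s refl by (rule bij_betw_trans)
  then have E: "bij_betw f (Inr ` edges G) {?P + 1..?P + ?Q}"
    by (auto simp: f_def bij_betw_def inj_on_def image_image)
  have "bij_betw f (Inl ` verts G \<union> Inr ` edges G) ({1..?P} \<union> {?P + 1..?P + ?Q})"
    using V E by (rule bij_betw_combine) auto
  moreover have "{1..?P} \<union> {?P + 1..?P + ?Q} = {1..?P + ?Q}"
    by auto
  ultimately have bij: "bij_betw f (verts G <+> edges G) {1..?P + ?Q}"
    by (simp add: Plus_def)
  have val: "has_valence G f k"
    unfolding has_valence_def
  proof (intro allI impI)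
    fix x y assume e: "{x, y} \<in> edges G"
    then have "x \<noteq> y"
      using G by (auto simp: simple_graph_def)
    moreover have "sum g {x, y} < c + ?Q"
      using bij_betwE[OF s] e by auto
    ultimately show "f (Inl x) + f (Inr {x, y}) + f (Inl y) = k"
      by (simp add: f_def k_def)
  qed
  have "f ` Inl ` verts G = {1..?P}"
    using V by (simp add: bij_betw_def)
  then have "super_edge_magic_labeling G f"
    using bij val by (auto simp: super_edge_magic_labeling_def edge_magic_labeling_def)
  then show ?thesis
    using val unfolding k_def by blast
qed

section \<open>Extremal sums of sets of labels\<close>

lemma sum_ge_triangular:
  fixes A :: "nat set"
  assumes "finite A" "0 \<notin> A"
  shows "card A * (card A + 1) \<le> 2 * \<Sum>A"
  using assms
proof (induction A rule: finite_linorder_max_induct)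
  case empty
  then show ?case by simp
next
  case (insert b A)
  have "insert b A \<subseteq> {1..b}"
    using insert by (force simp: Suc_le_eq intro!: Nat.gr0I)
  from card_mono[OF _ this] have "Suc (card A) \<le> b"
    using insert by (auto simp: card_insert_if)
  moreover have "b \<notin> A"
    using insert by auto
  ultimately show ?case
    using insert by simp
qed

text \<open>The reflection \<open>x \<mapsto> N + 1 - x\<close> turns the lower bound into an upper one.\<close>

lemma sum_le_top_triangular:
  fixes A :: "nat set"
  assumes "A \<subseteq> {1..N}"
  shows "2 * \<Sum>A + card A * (card A + 1) \<le> 2 * (N + 1) * card A"
proof -
  let ?B = "(\<lambda>x. N + 1 - x) ` A"
  have fin: "finite A"
    using assms finite_subset by blast
  have inj: "inj_on (\<lambda>x. N + 1 - x) A"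
    using assms by (fastforce simp: inj_on_def)
  have "0 \<notin> ?B"
    using assms by fastforce
  then have "card A * (card A + 1) \<le> 2 * \<Sum>?B"
    using sum_ge_triangular[of ?B] fin card_image[OF inj] by simp
  moreover have "\<Sum>?B + \<Sum>A = (N + 1) * card A"
  proof -
    have "\<Sum>?B + \<Sum>A = (\<Sum>x\<in>A. (N + 1 - x) + x)"
      using sum.reindex[OF inj, of "\<lambda>x. x"] by (simp add: sum.distrib comp_def)
    also have "\<dots> = (\<Sum>x\<in>A. N + 1)"
      using assms by (intro sum.cong) auto
    finally show ?thesis
      by simp
  qed
  ultimately show ?thesis
    by (simp add: algebra_simps)
qed

section \<open>The structure of a crown\<close>

abbreviation crown :: "nat \<Rightarrow> nat \<Rightarrow> (nat + nat \<times> nat) ugraph" where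
  "crown m n \<equiv> corona (cycle_graph m) (edgeless_graph n)"

text \<open>A functional orientation of the crown: every vertex \<open>x\<close> is the tail of exactly one edge, and the
  head of this edge is the cycle vertex with index \<open>hub m x\<close>.\<close>

fun hub :: "nat \<Rightarrow> nat + nat \<times> nat \<Rightarrow> nat" where
  "hub m (Inl v) = Suc v mod m"
| "hub m (Inr (v, w)) = v"

lemma verts_crown: "verts (crown m n) = {..<m} <+> {..<m} \<times> {..<n}"
  by (simp add: corona_def cycle_graph_def edgeless_graph_def)

lemma card_verts_crown: "card (verts (crown m n)) = m * (n + 1)"
  by (simp add: verts_crown card_Plus)

lemma simple_graph_crown: "m \<ge> 3 \<Longrightarrow> simple_graph (crown m n)"
  by (simp add: simple_graph_corona simple_graph_cycle simple_graph_edgeless)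

lemma Suc_mod_if: "v < m \<Longrightarrow> Suc v mod m = (if Suc v = m then 0 else Suc v)"
  by auto

lemma hub_less: "x \<in> verts (crown m n) \<Longrightarrow> hub m x < m"
  by (cases x) (auto simp: verts_crown)

lemma hub_neq:
  assumes "m \<ge> 3" "x \<in> verts (crown m n)"
  shows "Inl (hub m x) \<noteq> x"
  using assms by (cases x) (auto simp: verts_crown Suc_mod_if split: if_splits)

text \<open>No edge is oriented both ways; for the cycle this needs \<open>m > 2\<close>.\<close>

lemma hub_hub_neq:
  assumes "m \<ge> 3" "x \<in> verts (crown m n)"
  shows "Inl (hub m (Inl (hub m x))) \<noteq> x"
proof (cases x)
  case (Inl v)
  then have "v < m"
    using assms(2) by (auto simp: verts_crown)
  then consider "Suc v = m" | "Suc (Suc v) = m" | "Suc (Suc v) < m"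
    by linarith
  then have "Suc (Suc v mod m) mod m \<noteq> v"
    using assms(1) by cases auto
  then show ?thesis
    by (simp add: Inl)
qed simp

lemma bij_betw_edges_crown:
  assumes "m \<ge> 3"
  shows "bij_betw (\<lambda>x. {x, Inl (hub m x)}) (verts (crown m n)) (edges (crown m n))"
  unfolding bij_betw_def
proof
  show "inj_on (\<lambda>x. {x, Inl (hub m x)}) (verts (crown m n))"
  proof (rule inj_onI)
    fix x y assume "y \<in> verts (crown m n)" "{x, Inl (hub m x)} = {y, Inl (hub m y)}"
    then show "x = y"
      using hub_hub_neq[OF assms] by (metis doubleton_eq_iff)
  qed
  have "(\<lambda>x. {x, Inl (hub m x)}) ` verts (crown m n)
      = (\<lambda>v. {Inl v, Inl (Suc v mod m)}) ` {..<m}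
      \<union> (\<lambda>(v, w). {Inl v, Inr (v, w)}) ` ({..<m} \<times> {..<n})"
    unfolding verts_crown Plus_def image_Un image_image
    by (intro arg_cong2[of _ _ _ _ "(\<union>)"] image_cong) auto
  also have "(\<lambda>v. {Inl v, Inl (Suc v mod m)}) ` {..<m}
      = (`) Inl ` (\<lambda>v. {v, Suc v mod m}) ` {..<m}"
    by (simp add: image_image)
  also have "\<dots> \<union> (\<lambda>(v, w). {Inl v, Inr (v, w)}) ` ({..<m} \<times> {..<n})
      = edges (crown m n)"
  proof -
    have "{Inl ` e | e. e \<in> {{i, Suc i mod m} | i. i < m}}
        = ((`) Inl ` (\<lambda>v. {v, Suc v mod m}) ` {..<m} :: (nat + nat \<times> nat) set set)"
      by blast
    moreover have "{{Inl v, Inr (v, w)} | v w. v \<in> {..<m} \<and> w \<in> {..<n}}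
        = (\<lambda>(v, w). {Inl v, Inr (v, w)}) ` ({..<m} \<times> {..<n})"
      by auto
    ultimately show ?thesis
      by (simp add: corona_def cycle_graph_def edgeless_graph_def)
  qed
  finally show "(\<lambda>x. {x, Inl (hub m x)}) ` verts (crown m n) = edges (crown m n)" .
qed

lemma sum_edge_crown:
  assumes "m \<ge> 3" "x \<in> verts (crown m n)"
  shows "sum g {x, Inl (hub m x)} = g x + g (Inl (hub m x))"
  using hub_neq[OF assms] by simp

lemma card_edges_crown: "m \<ge> 3 \<Longrightarrow> card (edges (crown m n)) = m * (n + 1)"
  using bij_betw_same_card[OF bij_betw_edges_crown] card_verts_crown by metis

lemma bij_betw_Suc_mod:
  assumes "m > 0"
  shows "bij_betw (\<lambda>v. Suc v mod m) {..<m} {..<m}"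
proof -
  have "inj_on (\<lambda>v. Suc v mod m) {..<m}"
    using assms by (auto simp: inj_on_def Suc_mod_if split: if_splits)
  moreover from this have "(\<lambda>v. Suc v mod m) ` {..<m} = {..<m}"
    using assms by (intro endo_inj_surj) auto
  ultimately show ?thesis
    by (simp add: bij_betw_def)
qed

text \<open>Along the orientation, every vertex is once a tail, and every cycle vertex is \<open>n + 1\<close> times a head:
  of the edges from its \<open>n\<close> leaves and of the edge from its predecessor.\<close>

lemma sum_degrees_crown:
  fixes g :: "nat + nat \<times> nat \<Rightarrow> nat"
  assumes m: "m \<ge> 3"
  shows "(\<Sum>u\<in>verts (crown m n). degree (crown m n) u * g u)
       = sum g (verts (crown m n)) + (n + 1) * (\<Sum>v<m. g (Inl v))"
proof -
  let ?V = "verts (crown m n)"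
  have "(\<Sum>u\<in>?V. degree (crown m n) u * g u) = (\<Sum>e\<in>edges (crown m n). sum g e)"
    using m by (intro sum_degrees_eq_sum_edges simple_graph_crown)
  also have "\<dots> = (\<Sum>x\<in>?V. sum g {x, Inl (hub m x)})"
    by (rule sum.reindex_bij_betw[OF bij_betw_edges_crown[OF m], symmetric])
  also have "\<dots> = (\<Sum>x\<in>?V. g x + g (Inl (hub m x)))"
    by (intro sum.cong refl sum_edge_crown[OF m])
  also have "\<dots> = sum g ?V + (\<Sum>x\<in>?V. g (Inl (hub m x)))"
    by (rule sum.distrib)
  also have "(\<Sum>x\<in>?V. g (Inl (hub m x)))
      = (\<Sum>v<m. g (Inl (Suc v mod m))) + (\<Sum>v<m. \<Sum>w<n. g (Inl v))"
    unfolding verts_crown sum.cartesian_product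
    by (subst sum.Plus) (auto intro!: sum.cong arg_cong2[of _ _ _ _ "(+)"])
  also have "(\<Sum>v<m. g (Inl (Suc v mod m))) = (\<Sum>v<m. g (Inl v))"
    using m by (intro sum.reindex_bij_betw[OF bij_betw_Suc_mod]) auto
  finally show ?thesis
    by (simp add: sum_distrib_left sum.distrib)
qed

section \<open>The super edge-magic interval of a crown\<close>

lemma sem_sums_crown:
  assumes m: "m \<ge> 3" and s: "s \<in> sem_sums (crown m n)"
  obtains A where "A \<subseteq> {1..m * (n + 1)}" "card A = m"
    "s = \<Sum>A / m + (2 * m * (n + 1) + 1)"
proof -
  let ?V = "verts (crown m n)"
  define N where "N = m * (n + 1)"
  have "N > 0"
    using m by (simp add: N_def)
  obtain g where g: "bij_betw g ?V {1..N}" and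
    s: "s = 1 / real N * ((\<Sum>u\<in>?V. real (degree (crown m n) u) * real (g u))
          + (\<Sum>i = N + 1..N + N. real i))"
    using s unfolding sem_sums_def card_verts_crown card_edges_crown[OF m] N_def by blast
  define A where "A = (\<lambda>v. g (Inl v)) ` {..<m}"
  have inj: "inj_on (\<lambda>v. g (Inl v)) {..<m}"
    using g by (auto simp: bij_betw_def inj_on_def verts_crown)
  have "A \<subseteq> {1..N}" "card A = m"
    using bij_betwE[OF g] inj by (auto simp: A_def card_image verts_crown)
  moreover have "s = \<Sum>A / m + (2 * N + 1)"
  proof -
    have "(\<Sum>u\<in>?V. degree (crown m n) u * g u) + (\<Sum>i = N + 1..N + N. i)
        = (n + 1) * \<Sum>A + (\<Sum>{1..N} + \<Sum>{N + 1..N + N})"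
      using sum.reindex_bij_betw[OF g, of "\<lambda>i. i"]
      by (simp add: sum_degrees_crown[OF m] A_def sum.reindex[OF inj])
    also have "\<Sum>{1..N} + \<Sum>{N + 1..N + N} = \<Sum>{1..N + N}"
      using sum.ub_add_nat[of 1 N "\<lambda>i. i" N] by simp
    also have "\<dots> = N * (2 * N + 1)"
      using double_gauss_sum_from_Suc_0[of "N + N", where 'a = nat]
      by (simp add: algebra_simps)
    finally have "real ((\<Sum>u\<in>?V. degree (crown m n) u * g u) + (\<Sum>i = N + 1..N + N. i))
        = real ((n + 1) * \<Sum>A + N * (2 * N + 1))"
      by (rule arg_cong)
    then have "s = 1 / real N * real ((n + 1) * \<Sum>A + N * (2 * N + 1))"
      unfolding s by simp
    also have "real ((n + 1) * \<Sum>A + N * (2 * N + 1)) = real N * (\<Sum>A / m + (2 * N + 1))"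
      using m by (simp add: N_def field_simps)
    finally show ?thesis
      using \<open>N > 0\<close> by simp
  qed
  ultimately show thesis
    using that by (simp add: N_def mult.assoc)
qed

text \<open>The average of \<open>m\<close> distinct labels from \<open>1..m (n + 1)\<close> lies between \<open>h + 1\<close> and
  \<open>h + 1 + m n\<close>, the averages of the first and of the last \<open>m\<close> labels.\<close>

lemma sem_sums_crown_bounds:
  assumes m: "m = 2 * h + 1" "m \<ge> 3" and s: "s \<in> sem_sums (crown m n)"
  shows "real (2 * m * (n + 1) + h + 2) \<le> s" "s \<le> real (2 * m * (n + 1) + h + 2 + m * n)"
proof -
  obtain A where A: "A \<subseteq> {1..m * (n + 1)}" "card A = m"
    and s: "s = \<Sum>A / m + (2 * m * (n + 1) + 1)"
    using sem_sums_crown[OF m(2) s] .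
  have "0 \<notin> A" "finite A"
    using A(1) finite_subset by auto
  then have "m * (m + 1) \<le> 2 * \<Sum>A"
    using sum_ge_triangular[of A] A(2) by simp
  then have "m * (h + 1) \<le> \<Sum>A"
    using m(1) by (simp add: algebra_simps)
  then have "real m * real (h + 1) \<le> real (\<Sum>A)"
    by (metis of_nat_mono of_nat_mult)
  then show "real (2 * m * (n + 1) + h + 2) \<le> s"
    using m(2) unfolding s by (simp add: field_simps)
  have "2 * \<Sum>A + m * (m + 1) \<le> 2 * (m * (n + 1) + 1) * m"
    using sum_le_top_triangular[OF A(1)] A(2) by simp
  then have "\<Sum>A \<le> m * (m * n + h + 1)"
    using m(1) by (simp add: algebra_simps)
  then have "real (\<Sum>A) \<le> real m * real (m * n + h + 1)"
    by (metis of_nat_mono of_nat_mult)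
  then show "s \<le> real (2 * m * (n + 1) + h + 2 + m * n)"
    using m(2) unfolding s by (simp add: field_simps)
qed

section \<open>Labelings of odd crowns\<close>

text \<open>If \<open>a\<close> enumerates a window of \<open>m\<close> consecutive numbers, the translates of the window by
  \<open>0, m, \<dots>, n m\<close> tile an interval.  The vertex labels come from a window at \<open>0\<close> and the edge sums
  from a window at an arbitrary place.\<close>

lemma bij_betw_mixed_radix:
  fixes a :: "nat \<Rightarrow> nat"
  assumes m: "m > 0" and inj: "inj_on (\<lambda>u. a u mod m) {..<m}"
    and range: "\<And>u. u < m \<Longrightarrow> c \<le> a u \<and> a u < c + m"
  shows "bij_betw (\<lambda>(u, i). m * i + a u + k) ({..<m} \<times> {..n}) {c + k..<c + k + m * (n + 1)}"
proof -
  let ?F = "\<lambda>(u, i). m * i + a u + k" and ?D = "{..<m} \<times> {..n}"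
  have i: "inj_on ?F ?D"
  proof (rule inj_onI)
    fix x y assume "x \<in> ?D" "y \<in> ?D" "?F x = ?F y"
    then obtain u i u' i' where xy: "x = (u, i)" "y = (u', i')"
      and u: "u \<in> {..<m}" "u' \<in> {..<m}" and eq: "m * i + a u = m * i' + a u'"
      by auto
    have "a u mod m = a u' mod m"
      using arg_cong[OF eq, of "\<lambda>x. x mod m"] by simp
    then have "u = u'"
      using inj_onD[OF inj _ u] by blast
    moreover have "i = i'"
      using eq m unfolding \<open>u = u'\<close> by simp
    ultimately show "x = y"
      by (simp add: xy)
  qed
  have "?F ` ?D \<subseteq> {c + k..<c + k + m * (n + 1)}"
  proof (rule image_subsetI)
    fix x assume "x \<in> ?D"
    then obtain u i where x: "x = (u, i)" "u < m" "i \<le> n"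
      by auto
    then have "c \<le> a u" "a u < c + m" "m * i \<le> m * n"
      using range by auto
    then have "c + k \<le> m * i + a u + k" "m * i + a u + k < c + k + (m * n + m)"
      by linarith+
    then show "?F x \<in> {c + k..<c + k + m * (n + 1)}"
      by (simp add: x)
  qed
  then have "?F ` ?D = {c + k..<c + k + m * (n + 1)}"
    using card_image[OF i] by (intro card_subset_eq) auto
  then show ?thesis
    using i by (simp add: bij_betw_def)
qed

text \<open>Around the cycle, \<open>hub_pos h\<close> takes the values \<open>0, h + 1, 1, h + 2, \<dots>, 2 h, h\<close>, and
  \<open>spoke_pos h u\<close> is the value at the predecessor of \<open>u\<close>.  The closed formula for
  \<open>spoke_pos\<close> makes the sum of the two linear in \<open>u\<close>.\<close>

definition hub_pos :: "nat \<Rightarrow> nat \<Rightarrow> nat" where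
  "hub_pos h u = (if even u then u div 2 else h + 1 + u div 2)"

definition spoke_pos :: "nat \<Rightarrow> nat \<Rightarrow> nat" where
  "spoke_pos h u = (if even u then h + u div 2 else u div 2)"

lemma hub_pos_add_spoke_pos: "hub_pos h u + spoke_pos h u = h + u"
  by (auto simp: hub_pos_def spoke_pos_def elim!: evenE oddE)

lemma spoke_pos_Suc_mod:
  assumes "v < 2 * h + 1"
  shows "spoke_pos h (Suc v mod (2 * h + 1)) = hub_pos h v"
proof (cases "Suc v = 2 * h + 1")
  case True
  then have "v = 2 * h" by simp
  then show ?thesis
    by (simp add: hub_pos_def spoke_pos_def)
next
  case False
  then have "Suc v mod (2 * h + 1) = Suc v"
    using assms by simp
  then show ?thesis
    by (auto simp: hub_pos_def spoke_pos_def elim!: oddE)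
qed

lemma spoke_pos_less: "u < 2 * h + 1 \<Longrightarrow> spoke_pos h u < 2 * h + 1"
  by (auto simp: spoke_pos_def)

lemma inj_on_spoke_pos: "inj_on (spoke_pos h) {..<2 * h + 1}"
  by (rule inj_onI) (auto simp: spoke_pos_def split: if_splits elim!: evenE oddE)

text \<open>The order-preserving enumeration of the natural numbers other than \<open>k\<close>.\<close>

definition skip :: "nat \<Rightarrow> nat \<Rightarrow> nat" where
  "skip k w = (if w < k then w else Suc w)"

lemma skip_neq: "skip k w \<noteq> k"
  by (simp add: skip_def)

lemma skip_eq_iff: "skip k w = skip k w' \<longleftrightarrow> w = w'"
  by (auto simp: skip_def)

lemma skip_le: "k \<le> n \<Longrightarrow> w < n \<Longrightarrow> skip k w \<le> n"
  by (simp add: skip_def)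

text \<open>The slot of a vertex consists of its hub and of a level that distinguishes the vertices with the
  same hub.  The levels \<open>r v\<close> of the cycle vertices are prescribed; the leaves at \<open>v\<close> share
  their hub with the predecessor of \<open>v\<close> on the cycle and take the levels that it leaves free.  Here
  \<open>v + m - 1\<close> avoids truncated subtraction at \<open>v = 0\<close>.\<close>

fun slot :: "nat \<Rightarrow> (nat \<Rightarrow> nat) \<Rightarrow> nat + nat \<times> nat \<Rightarrow> nat \<times> nat" where
  "slot m r (Inl v) = (Suc v mod m, r v)"
| "slot m r (Inr (v, w)) = (v, skip (r ((v + m - 1) mod m)) w)"

lemma fst_slot: "fst (slot m r x) = hub m x"
  by (cases x) auto

lemma bij_betw_slot:
  assumes m: "m > 0" and r: "\<And>v. v < m \<Longrightarrow> r v \<le> n"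
  shows "bij_betw (slot m r) (verts (crown m n)) ({..<m} \<times> {..n})"
proof -
  let ?V = "verts (crown m n)"
  have pred: "(Suc v mod m + m - 1) mod m = v" if "v < m" for v
    using that m by (cases "Suc v = m") auto
  have clash: "r v \<noteq> skip (r ((Suc v mod m + m - 1) mod m)) w" if "v < m" for v w
    unfolding pred[OF that] by (rule skip_neq[symmetric])
  have i: "inj_on (slot m r) ?V"
  proof (rule inj_onI)
    fix x y assume "x \<in> ?V" "y \<in> ?V" "slot m r x = slot m r y"
    then consider v v' where "x = Inl v" "y = Inl v'" "v < m" "v' < m" "Suc v mod m = Suc v' mod m"
      | u w w' k where "x = Inr (u, w)" "y = Inr (u, w')" "skip k w = skip k w'"
      using clash clash[symmetric] by (auto simp: verts_crown simp del: One_nat_def)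
    then show "x = y"
    proof cases
      case 1
      then show ?thesis
        using inj_onD[OF bij_betw_imp_inj_on[OF bij_betw_Suc_mod[OF m]], of v v'] by simp
    next
      case 2
      then show ?thesis
        by (simp add: skip_eq_iff)
    qed
  qed
  have "slot m r x \<in> {..<m} \<times> {..n}" if "x \<in> ?V" for x
    using that r m by (cases x) (auto simp: verts_crown intro!: skip_le)
  then have "slot m r ` ?V \<subseteq> {..<m} \<times> {..n}"
    by blast
  then have "slot m r ` ?V = {..<m} \<times> {..n}"
    using card_image[OF i] card_verts_crown[of m n] by (intro card_subset_eq) auto
  then show ?thesis
    using i by (simp add: bij_betw_def)
qed

text \<open>A vertex in slot \<open>(u, i)\<close> gets the label \<open>m * i + spoke_pos h u + 1\<close>.  Levels of hubs and
  positions of hubs and spokes add up so that the edge sum is a function of the slot to which the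
  tiling lemma applies again.\<close>

lemma crown_has_valence:
  assumes m: "m = 2 * h + 1" "m \<ge> 3" and T: "T \<le> m * n"
  shows "\<exists>f. super_edge_magic_labeling (crown m n) f \<and>
             has_valence (crown m n) f (2 * m * (n + 1) + h + 2 + T)"
proof -
  let ?V = "verts (crown m n)" and ?N = "m * (n + 1)"
  \<comment> \<open>Rounding up: \<open>r u\<close> is the least number with \<open>T \<le> m * r u + u\<close>.\<close>
  define r where "r u = (T + m - 1 - u) div m" for u
  have m0: "m > 0" using m by simp
  have r_bounds: "T \<le> m * r u + u" "m * r u + u < T + m" if "u < m" for u
  proof -
    have "m * r u + (T + m - 1 - u) mod m = T + m - 1 - u"
      by (simp add: r_def)
    moreover have "(T + m - 1 - u) mod m < m"
      using m0 by simp
    ultimately show "T \<le> m * r u + u" "m * r u + u < T + m"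
      using that by linarith+
  qed
  have r_le: "r u \<le> n" if "u < m" for u
  proof -
    have "m * r u < m * (n + 1)"
      using r_bounds(2)[OF that] T by simp
    then show ?thesis
      using m0 by (simp only: mult_less_cancel1) simp
  qed
  have slot: "bij_betw (slot m r) ?V ({..<m} \<times> {..n})"
    using m0 r_le by (rule bij_betw_slot)
  define g where "g = (\<lambda>(u, i). m * i + spoke_pos h u + 1) \<circ> slot m r"
  \<comment> \<open>A cycle vertex is a spoke of its successor; this is where the position \<open>hub_pos\<close> of a hub
     arises.\<close>
  have g_hub: "g (Inl v) = m * r v + hub_pos h v + 1" if "v < m" for v
    using that spoke_pos_Suc_mod[of v h] m(1) by (simp add: g_def)
  have "inj_on (\<lambda>u. spoke_pos h u mod m) {..<m}"
    using inj_on_spoke_pos[of h] spoke_pos_less[of _ h] m(1) by (simp add: inj_on_def)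
  then have "bij_betw (\<lambda>(u, i). m * i + spoke_pos h u + 1) ({..<m} \<times> {..n}) {0 + 1..<0 + 1 + ?N}"
    using m0 spoke_pos_less[of _ h] m(1) by (intro bij_betw_mixed_radix) auto
  then have g: "bij_betw g ?V {1..card ?V}"
    unfolding g_def card_verts_crown using slot bij_betw_trans
    by (fastforce simp: atLeastLessThanSuc_atLeastAtMost)
  define c where "c = T + (h + 2)"
  have "inj_on (\<lambda>u. (m * r u + u) mod m) {..<m}"
    by (simp add: inj_on_def)
  then have "bij_betw (\<lambda>(u, i). m * i + (m * r u + u) + (h + 2)) ({..<m} \<times> {..n})
      {T + (h + 2)..<T + (h + 2) + ?N}"
    using r_bounds by (intro bij_betw_mixed_radix m0) auto
  then have "bij_betw ((\<lambda>(u, i). m * i + (m * r u + u) + (h + 2)) \<circ> slot m r) ?V {c..<c + ?N}"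
    unfolding c_def using slot bij_betw_trans by blast
  moreover have "((\<lambda>(u, i). m * i + (m * r u + u) + (h + 2)) \<circ> slot m r) x
      = (sum g \<circ> (\<lambda>x. {x, Inl (hub m x)})) x" if x: "x \<in> ?V" for x
  proof -
    obtain i where i: "slot m r x = (hub m x, i)"
      using fst_slot by (metis prod.collapse)
    then show ?thesis
      using g_hub[OF hub_less[OF x]] hub_pos_add_spoke_pos[of h "hub m x"]
      by (simp add: sum_edge_crown[OF m(2) x] del: sum.insert) (simp add: g_def)
  qed
  ultimately have "bij_betw (sum g \<circ> (\<lambda>x. {x, Inl (hub m x)})) ?V {c..<c + ?N}"
    by (simp cong: bij_betw_cong)
  then have "bij_betw (sum g) (edges (crown m n)) {c..<c + card (edges (crown m n))}"
    unfolding card_edges_crown[OF m(2)]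
    using bij_betw_comp_iff[OF bij_betw_edges_crown[OF m(2)]] by blast
  from super_edge_magic_labeling_if_consecutive_sums[OF simple_graph_crown[OF m(2)] g this]
  obtain f where "super_edge_magic_labeling (crown m n) f"
    and "has_valence (crown m n) f (c + ?N + ?N)"
    unfolding card_verts_crown card_edges_crown[OF m(2)] by blast
  moreover have "c + ?N + ?N = 2 * m * (n + 1) + h + 2 + T"
    by (simp add: c_def)
  ultimately show ?thesis
    by metis
qed

section \<open>Perfect crowns\<close>

theorem perfect_super_edge_magic_odd_crown:
  assumes "odd m" "m \<ge> 3"
  shows "perfect_super_edge_magic (crown m n)"
proof -
  obtain h where h: "m = 2 * h + 1"
    using assms by (auto elim: oddE)
  let ?lo = "2 * m * (n + 1) + h + 2"
  have simple: "simple_graph (crown m n)" and fin: "finite (verts (crown m n))"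
    using simple_graph_crown[OF assms(2)] by (auto simp: simple_graph_def)
  have "card (edges (crown m n)) \<noteq> 0"
    using assms by (simp add: card_edges_crown)
  then have ne: "edges (crown m n) \<noteq> {}"
    by (metis card.empty)
  have mem: "real (?lo + T) \<in> sem_sums (crown m n)" if "T \<le> m * n" for T
    using crown_has_valence[OF h assms(2) that] valence_in_sem_sums[OF simple ne] by blast
  have min: "Min (sem_sums (crown m n)) = real ?lo"
    using finite_sem_sums[OF fin] sem_sums_crown_bounds(1)[OF h assms(2)] mem[of 0]
    by (intro Min_eqI) auto
  have max: "Max (sem_sums (crown m n)) = real (?lo + m * n)"
    by (rule Max_eqI[OF finite_sem_sums[OF fin] sem_sums_crown_bounds(2)[OF h assms(2)]
        mem[OF order.refl]])
  have interval: "sem_interval (crown m n) = {int ?lo..int (?lo + m * n)}"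
    unfolding sem_interval_def min max ceiling_of_nat floor_of_nat ..
  have "k \<in> sem_set (crown m n)" if k: "k \<in> sem_interval (crown m n)" for k
  proof -
    have "\<exists>T\<le>b. k = int (a + T)" if "k \<in> {int a..int (a + b)}" for a b
      using that by (intro exI[of _ "nat (k - int a)"]) auto
    then obtain T where "T \<le> m * n" "k = int (?lo + T)"
      using k unfolding interval by blast
    then show ?thesis
      using crown_has_valence[OF h assms(2)] k unfolding sem_set_def by blast
  qed
  then have "sem_set (crown m n) = sem_interval (crown m n)"
    by (auto simp: sem_set_def)
  moreover have "sem_interval_defined (crown m n)"
    unfolding sem_interval_defined_def min max ceiling_of_nat floor_of_nat by simp
  ultimately show ?thesis
    by (simp add: perfect_super_edge_magic_def)
qed

theorem theorem3p1:
  fixes m n p q :: nat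
  assumes "prime p" and "prime q" and "odd p" and "odd q" and "p \<noteq> q"
    and "m = p * q" and "n \<ge> 1"
  shows "perfect_super_edge_magic (corona (cycle_graph m) (edgeless_graph n))"
proof -
  have "p \<ge> 2" "q \<ge> 2"
    using assms prime_ge_2_nat by auto
  then have "2 * 2 \<le> m"
    unfolding assms(6) by (intro mult_le_mono)
  then show ?thesis
    using assms by (intro perfect_super_edge_magic_odd_crown) auto
qed

end
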